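(* Let $\Theta^* \in \mathbb{R}^{k\times p}$ have rank $r\ge 1$, let $X_1,\dots,X_N\in\mathbb{R}^{k\times p}$ and $\vec{\varepsilon}\in\mathbb{R}^N$, and let $\vec{y} = \mathfrak{X}(\Theta^* ) + \vec{\varepsilon}$, where $[\mathfrak{X}(\Theta)]_i = \operatorname{trace}(X_i^T\Theta)$. Suppose that $\mathfrak{X}$ satisfies restricted strong convexity with parameter $\kappa(\mathfrak{X})>0$ over the set $\mathcal{C}(r;0)$. Then, as long as $\lambda_N>0$ satisfies $\lambda_N \ge 2\,\|\mathfrak{X}^*(\vec{\varepsilon})\|_{\mathrm{op}}/N$, any optimal solution $$\widehat\Theta \in \arg\min_{\Theta\in\mathbb{R}^{k\times p}} \Big\{ \frac{1}{2N}\|\vec{y}-\mathfrak{X}(\Theta)\|_2^2 + \lambda_N \|\Theta\|_1\Big\}$$ satisfies $$\|\widehat\Theta-\Theta^*\|_F \le \frac{32\sqrt{r}\,\lambda_N}{\kappa(\mathfrak{X})}.$$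
   Context: For a matrix $\Theta$, $\|\Theta\|_1$ denotes the nuclear norm (sum of singular values), $\|\Theta\|_{\mathrm{op}}$ the largest singular value, and $\|\Theta\|_F$ the Frobenius norm. The adjoint of $\mathfrak{X}:\mathbb{R}^{k\times p}\to\mathbb{R}^N$ is $\mathfrak{X}^*(\vec\varepsilon)=\sum_{i=1}^N \varepsilon_i X_i$. Fix a singular value decomposition of $\Theta^*$ with singular values in non-increasing order. $U^r\in\mathbb{R}^{k\times r}$ and $V^r\in\mathbb{R}^{p\times r}$ are the matrices with orthonormal columns consisting of the top $r$ left and right singular vectors of $\Theta^*$. For matrices $U\in\mathbb{R}^{k\times r}$, $V\in\mathbb{R}^{p\times r}$ with orthonormal columns, $\mathcal{M}^\perp(U,V)$ is the subspace of matrices $\Theta\in\mathbb{R}^{k\times p}$ whose row space is orthogonal to the column span of $V$ and whose column space is orthogonal to the column span of $U$; $\Pi_{\mathcal{M}^\perp(U,V)}$ is the orthogonal projection onto it, i.e. $\Theta\mapsto (I-UU^T)\Theta(I-VV^T)$. For $\Delta\in\mathbb{R}^{k\times p}$ write $\Delta''=\Pi_{\mathcal{M}^\perp(U^r,V^r)}(\Delta)$ and $\Delta'=\Delta-\Delta''$. For $\delta\ge0$ define $$\mathcal{C}(r;\delta)=\Big\{\Delta\in\mathbb{R}^{k\times p}\ :\ \|\Delta\|_F\ge\delta,\ \|\Delta''\|_1\le 3\|\Delta'\|_1+4\|\Pi_{\mathcal{M}^\perp(U^r,V^r)}(\Theta^* )\|_1\Big\}.$$ (When $\Theta^*$ has rank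 $r$, the last term is zero.) The operator $\mathfrak{X}$ satisfies restricted strong convexity (RSC) with parameter $\kappa(\mathfrak{X})>0$ over a set $\mathcal{C}$ if $\frac{1}{2N}\|\mathfrak{X}(\Delta)\|_2^2\ge\kappa(\mathfrak{X})\|\Delta\|_F^2$ for all $\Delta\in\mathcal{C}$. *)

theory Defs
  imports "HOL-Analysis.Analysis"
begin

text \<open>
  A \<open>k \<times> p\<close> matrix is a \<^typ>\<open>real^'p^'k\<close>; the library's \<^const>\<open>norm\<close> and inner
  product on this type are the Frobenius norm and the trace inner product.
  Families of \<open>r\<close> vectors, with \<open>r\<close> a natural number, are functions on \<^typ>\<open>nat\<close>
  of which only the values at indices below \<open>r\<close> matter.
\<close>

subsection \<open>Singular values and matrix norms\<close>

definition eigenspace :: "real^'n^'n \<Rightarrow> real \<Rightarrow> (real^'n) set" where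
  "eigenspace A c = {v. A *v v = c *\<^sub>R v}"

text \<open>
  The singular values of \<open>A\<close> are the square roots of the eigenvalues of
  \<open>A\<^sup>T A\<close>.  If \<open>k < p\<close> there are \<open>p\<close> of them with multiplicity rather than \<open>min k p\<close>;
  the additional ones are zero, so neither norm below is affected.
\<close>

definition singular_values :: "real^'p^'k \<Rightarrow> real set" where
  "singular_values A = {s. s \<ge> 0 \<and> (\<exists>v. v \<noteq> 0 \<and> v \<in> eigenspace (transpose A ** A) (s\<^sup>2))}"

definition singular_value_mult :: "real^'p^'k \<Rightarrow> real \<Rightarrow> nat" where
  "singular_value_mult A s = dim (eigenspace (transpose A ** A) (s\<^sup>2))"

definition nuclear_norm :: "real^'p^'k \<Rightarrow> real" where
  "nuclear_norm A = (\<Sum>s\<in>singular_values A. real (singular_value_mult A s) * s)"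

definition op_norm :: "real^'p^'k \<Rightarrow> real" where
  "op_norm A = Max (singular_values A)"

lemma finite_singular_values: "finite (singular_values A)"
proof -
  let ?B = "transpose A ** A"
  have "\<forall>s\<in>singular_values A. \<exists>v. v \<noteq> 0 \<and> ?B *v v = s\<^sup>2 *\<^sub>R v"
    by (auto simp: singular_values_def eigenspace_def)
  then obtain f where f: "\<And>s. s \<in> singular_values A \<Longrightarrow> f s \<noteq> 0 \<and> ?B *v f s = s\<^sup>2 *\<^sub>R f s"
    by metis
  have sym: "(?B *v x) \<bullet> y = x \<bullet> (?B *v y)" for x y
    by (metis dot_lmul_matrix matrix_transpose_mul transpose_transpose vector_transpose_matrix)
  have orth: "f s \<bullet> f t = 0" if "s \<in> singular_values A" "t \<in> singular_values A" "s \<noteq> t" for s t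
  proof -
    have "s\<^sup>2 * (f s \<bullet> f t) = t\<^sup>2 * (f s \<bullet> f t)"
      using sym[of "f s" "f t"] f that by simp
    moreover have "s\<^sup>2 \<noteq> t\<^sup>2"
      using that by (auto simp: singular_values_def)
    ultimately show ?thesis by simp
  qed
  have inj: "inj_on f (singular_values A)"
    by (rule inj_onI) (metis f inner_eq_zero_iff orth)
  have "independent (f ` singular_values A)"
  proof (rule pairwise_orthogonal_independent)
    show "pairwise orthogonal (f ` singular_values A)"
      by (auto simp: pairwise_def orthogonal_def intro: orth)
    show "0 \<notin> f ` singular_values A" using f by auto
  qed
  then have "finite (f ` singular_values A)"
    by (rule independent_imp_finite)
  with inj show ?thesis by (simp add: finite_image_iff)
qed


subsection \<open>Singular value decompositions\<close>

definition outer :: "real^'k \<Rightarrow> real^'p \<Rightarrow> real^'p^'k" where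
  "outer x y = (\<chi> i j. x $ i * y $ j)"

definition orthonormal :: "nat \<Rightarrow> (nat \<Rightarrow> real^'n) \<Rightarrow> bool" where
  "orthonormal m w \<longleftrightarrow> (\<forall>i<m. \<forall>j<m. w i \<bullet> w j = (if i = j then 1 else 0))"

definition is_svd :: "real^'p^'k \<Rightarrow> (nat \<Rightarrow> real^'k) \<Rightarrow> (nat \<Rightarrow> real) \<Rightarrow> (nat \<Rightarrow> real^'p) \<Rightarrow> bool" where
  "is_svd A u s v \<longleftrightarrow> (let m = min CARD('k) CARD('p) in
     orthonormal m u \<and> orthonormal m v \<and>
     (\<forall>i<m. s i \<ge> 0) \<and> (\<forall>i<m. \<forall>j<m. i \<le> j \<longrightarrow> s j \<le> s i) \<and>
     A = (\<Sum>i<m. s i *\<^sub>R outer (u i) (v i)))"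


subsection \<open>The subspace \<open>M\<^sup>\<bottom>(U, V)\<close> and its orthogonal projection\<close>

text \<open>
  For the matrix \<open>U\<close> whose columns are \<open>w 0, \<dots>, w (r - 1)\<close>, this is \<open>U U\<^sup>T\<close>.
\<close>

definition col_gram :: "nat \<Rightarrow> (nat \<Rightarrow> real^'n) \<Rightarrow> real^'n^'n" where
  "col_gram r w = (\<Sum>j<r. outer (w j) (w j))"

definition Mperp :: "nat \<Rightarrow> (nat \<Rightarrow> real^'k) \<Rightarrow> (nat \<Rightarrow> real^'p) \<Rightarrow> (real^'p^'k) set" where
  "Mperp r u v = {A. (\<forall>x \<in> span (rows A). \<forall>y \<in> span (v ` {..<r}). x \<bullet> y = 0) \<and>
                     (\<forall>x \<in> span (columns A). \<forall>y \<in> span (u ` {..<r}). x \<bullet> y = 0)}"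

definition proj_Mperp ::
    "nat \<Rightarrow> (nat \<Rightarrow> real^'k) \<Rightarrow> (nat \<Rightarrow> real^'p) \<Rightarrow> real^'p^'k \<Rightarrow> real^'p^'k" where
  "proj_Mperp r u v A = (mat 1 - col_gram r u) ** A ** (mat 1 - col_gram r v)"


lemma col_gram_mult:
  fixes w :: "nat \<Rightarrow> real^'n"
  shows "col_gram r w *v x = (\<Sum>j<r. (w j \<bullet> x) *\<^sub>R w j)"
proof -
  have *: "outer a b *v x = (b \<bullet> x) *\<^sub>R a" for a b x :: "real^'n"
    by (simp add: vec_eq_iff outer_def matrix_vector_mult_def inner_vec_def sum_distrib_right
        mult_ac sum_distrib_left)
  have "(\<Sum>j\<in>S. M j) *v x = (\<Sum>j\<in>S. M j *v x)" if "finite S"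
    for S :: "nat set" and M :: "nat \<Rightarrow> real^'n^'n" and x
    using that by induction (auto simp: matrix_vector_mult_add_rdistrib)
  then show ?thesis by (simp add: col_gram_def *)
qed

lemma transpose_col_gram: "transpose (col_gram r w) = col_gram r w"
  by (simp add: vec_eq_iff transpose_def col_gram_def outer_def mult.commute)

lemma col_gram_fix:
  assumes "orthonormal r w" "i < r" shows "col_gram r w *v w i = w i"
proof -
  have "(\<Sum>j<r. (w j \<bullet> w i) *\<^sub>R w j) = (\<Sum>j<r. if j = i then w j else 0)"
    using assms by (intro sum.cong) (auto simp: orthonormal_def)
  then show ?thesis using assms(2) by (simp add: col_gram_mult)
qed

lemma rows_perp_iff:
  fixes B :: "real^'m^'l" and w :: "nat \<Rightarrow> real^'m"
  shows "(\<forall>x\<in>span (rows B). \<forall>y\<in>span (w ` {..<r}). x \<bullet> y = 0) \<longleftrightarrow> (\<forall>j<r. B *v w j = 0)"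
proof
  assume L: "\<forall>x\<in>span (rows B). \<forall>y\<in>span (w ` {..<r}). x \<bullet> y = 0"
  show "\<forall>j<r. B *v w j = 0"
  proof (intro allI impI)
    fix j assume "j < r"
    have "row i B \<bullet> w j = 0" for i
    proof -
      have "row i B \<in> span (rows B)" by (rule span_base) (auto simp: rows_def)
      moreover have "w j \<in> span (w ` {..<r})" using \<open>j < r\<close> by (auto intro: span_base)
      ultimately show ?thesis using L by blast
    qed
    then show "B *v w j = 0"
      by (simp add: vec_eq_iff matrix_vector_mul_component row_def)
  qed
next
  assume R: "\<forall>j<r. B *v w j = 0"
  have base: "orthogonal x y" if x: "x \<in> rows B" and y: "y \<in> w ` {..<r}" for x y
  proof -
    obtain i where i: "x = B $ i" using x unfolding rows_def row_def vec_lambda_eta by blast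
    obtain j where "y = w j" "j < r" using y by blast
    note ij = i this
    with R have "(B *v w j) $ i = 0" by simp
    with ij show ?thesis by (simp add: orthogonal_def matrix_vector_mul_component)
  qed
  have row: "orthogonal y x" if "x \<in> rows B" "y \<in> span (w ` {..<r})" for x y
    using orthogonal_to_span[OF that(2), of x] base[OF that(1)] orthogonal_commute by blast
  have "orthogonal y x" if "x \<in> span (rows B)" "y \<in> span (w ` {..<r})" for x y
    using that(1) by (rule orthogonal_to_span) (rule row[OF _ that(2)])
  then show "\<forall>x\<in>span (rows B). \<forall>y\<in>span (w ` {..<r}). x \<bullet> y = 0"
    by (simp add: orthogonal_def inner_commute)
qed

lemma Mperp_iff:
  "A \<in> Mperp r u v \<longleftrightarrow> (\<forall>j<r. A *v v j = 0) \<and> (\<forall>j<r. transpose A *v u j = 0)"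
  unfolding Mperp_def using rows_perp_iff[of A v r] rows_perp_iff[of "transpose A" u r] by simp

lemma compl_col_gram_fix:
  assumes "orthonormal r w" "j < r" shows "(mat 1 - col_gram r w) *v w j = 0"
  using assms by (simp add: matrix_vector_mult_diff_rdistrib col_gram_fix)

lemma mult_compl_col_gram:
  fixes B :: "real^'m^'l"
  assumes "\<forall>j<r. B *v w j = 0" shows "B ** (mat 1 - col_gram r w) = B"
proof -
  have "B *v (col_gram r w *v x) = 0" for x
    using assms by (simp add: col_gram_mult linear_sum[OF matrix_vector_mul_linear]
        linear_scale[OF matrix_vector_mul_linear])
  then have "(B ** (mat 1 - col_gram r w)) *v x = B *v x" for x
    by (simp add: matrix_vector_mul_assoc[symmetric] matrix_vector_mult_diff_rdistrib
        matrix_vector_mult_diff_distrib)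
  then show ?thesis by (simp add: matrix_eq)
qed

lemma matrix_mult_inner:
  fixes M :: "real^'k^'k" and A B :: "real^'p^'k"
  shows "(M ** A) \<bullet> B = A \<bullet> (transpose M ** B)"
proof -
  have "(M ** A) \<bullet> B = (\<Sum>i\<in>UNIV. \<Sum>j\<in>UNIV. \<Sum>l\<in>UNIV. M$i$l * A$l$j * B$i$j)"
    by (simp add: inner_vec_def matrix_matrix_mult_def sum_distrib_right)
  also have "\<dots> = (\<Sum>i\<in>UNIV. \<Sum>l\<in>UNIV. \<Sum>j\<in>UNIV. M$i$l * A$l$j * B$i$j)"
    by (intro sum.cong refl sum.swap)
  also have "\<dots> = (\<Sum>l\<in>UNIV. \<Sum>i\<in>UNIV. \<Sum>j\<in>UNIV. M$i$l * A$l$j * B$i$j)"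
    by (rule sum.swap)
  also have "\<dots> = (\<Sum>l\<in>UNIV. \<Sum>j\<in>UNIV. \<Sum>i\<in>UNIV. M$i$l * A$l$j * B$i$j)"
    by (intro sum.cong refl sum.swap)
  also have "\<dots> = A \<bullet> (transpose M ** B)"
    by (simp add: inner_vec_def matrix_matrix_mult_def transpose_def sum_distrib_left mult_ac)
  finally show ?thesis .
qed

lemma transpose_inner:
  fixes A B :: "real^'p^'k"
  shows "transpose A \<bullet> transpose B = A \<bullet> B"
  by (simp add: inner_vec_def transpose_def) (rule sum.swap)

lemma proj_Mperp_eq_closest_point:
  fixes A :: "real^'p^'k"
  assumes u: "orthonormal r u" and v: "orthonormal r v"
  shows "proj_Mperp r u v A = closest_point (Mperp r u v) A"
proof (rule closest_point_unique)
  let ?P = "mat 1 - col_gram r u" and ?Q = "mat 1 - col_gram r v"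
  have tP: "transpose ?P = ?P" and tQ: "transpose ?Q = ?Q"
    using transpose_col_gram[of r u] transpose_col_gram[of r v]
    by (simp_all add: vec_eq_iff transpose_def mat_def eq_commute)
  have sub: "subspace (Mperp r u v)"
  proof -
    have t: "transpose (B + C) = transpose B + transpose C" "transpose (c *\<^sub>R B) = c *\<^sub>R transpose B"
      "transpose (0 :: real^'p^'k) = 0" for B C :: "real^'p^'k" and c
      by (simp_all add: vec_eq_iff transpose_def)
    show ?thesis
      by (simp add: subspace_def Mperp_iff t matrix_vector_mult_add_rdistrib
          scaleR_matrix_vector_assoc[symmetric])
  qed
  show "convex (Mperp r u v)" using sub by (rule subspace_imp_convex)
  show "closed (Mperp r u v)" using sub by (rule closed_subspace)
  show mem: "proj_Mperp r u v A \<in> Mperp r u v"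
    using compl_col_gram_fix[OF u] compl_col_gram_fix[OF v]
    by (simp add: Mperp_iff proj_Mperp_def matrix_transpose_mul tP tQ matrix_vector_mul_assoc[symmetric])
  have orth: "(A - proj_Mperp r u v A) \<bullet> B = 0" if "B \<in> Mperp r u v" for B
  proof -
    have BQ: "B ** ?Q = B" using that by (intro mult_compl_col_gram) (simp add: Mperp_iff)
    have "transpose B ** ?P = transpose B" using that by (intro mult_compl_col_gram) (simp add: Mperp_iff)
    then have PB: "?P ** B = B" by (metis matrix_transpose_mul tP transpose_transpose)
    have "proj_Mperp r u v A \<bullet> B = (?P ** (A ** ?Q)) \<bullet> B"
      by (simp add: proj_Mperp_def matrix_mul_assoc)
    also have "\<dots> = (A ** ?Q) \<bullet> B" by (simp only: matrix_mult_inner tP PB)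
    also have "\<dots> = (?Q ** transpose A) \<bullet> transpose B"
      by (metis matrix_transpose_mul tQ transpose_inner)
    also have "\<dots> = transpose A \<bullet> transpose (B ** ?Q)"
      by (simp only: matrix_mult_inner tQ matrix_transpose_mul)
    also have "\<dots> = A \<bullet> B" by (simp only: BQ transpose_inner)
    finally show ?thesis by (simp add: inner_diff_left)
  qed
  show "\<forall>Z\<in>Mperp r u v. dist A (proj_Mperp r u v A) \<le> dist A Z"
  proof
    fix Z assume Z: "Z \<in> Mperp r u v"
    let ?p = "proj_Mperp r u v A"
    have "orthogonal (A - ?p) (?p - Z)"
      unfolding orthogonal_def using orth subspace_diff[OF sub mem Z] by blast
    then have "(norm ((A - ?p) + (?p - Z)))\<^sup>2 = (norm (A - ?p))\<^sup>2 + (norm (?p - Z))\<^sup>2"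
      by (rule norm_add_Pythagorean)
    then have "(norm (A - ?p))\<^sup>2 \<le> (norm (A - Z))\<^sup>2" by simp
    then show "dist A ?p \<le> dist A Z" by (simp add: dist_norm)
  qed
qed


subsection \<open>The observation operator and restricted strong convexity\<close>

definition obs_op :: "('n \<Rightarrow> real^'p^'k) \<Rightarrow> real^'p^'k \<Rightarrow> real^'n" where
  "obs_op X A = (\<chi> i. trace (transpose (X i) ** A))"

definition obs_adj :: "('n::finite \<Rightarrow> real^'p^'k) \<Rightarrow> real^'n \<Rightarrow> real^'p^'k" where
  "obs_adj X e = (\<Sum>i\<in>UNIV. e $ i *\<^sub>R X i)"

definition cone_set ::
    "real^'p^'k \<Rightarrow> (nat \<Rightarrow> real^'k) \<Rightarrow> (nat \<Rightarrow> real^'p) \<Rightarrow> nat \<Rightarrow> real \<Rightarrow> (real^'p^'k) set" where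
  "cone_set Theta u v r \<delta> = {D. norm D \<ge> \<delta> \<and>
     nuclear_norm (proj_Mperp r u v D)
       \<le> 3 * nuclear_norm (D - proj_Mperp r u v D) + 4 * nuclear_norm (proj_Mperp r u v Theta)}"

definition RSC :: "('n::finite \<Rightarrow> real^'p^'k) \<Rightarrow> real \<Rightarrow> (real^'p^'k) set \<Rightarrow> bool" where
  "RSC X \<kappa> C \<longleftrightarrow>
     (\<forall>D\<in>C. 1 / (2 * real CARD('n)) * (norm (obs_op X D))\<^sup>2 \<ge> \<kappa> * (norm D)\<^sup>2)"

definition objective ::
    "('n::finite \<Rightarrow> real^'p^'k) \<Rightarrow> real^'n \<Rightarrow> real \<Rightarrow> real^'p^'k \<Rightarrow> real" where
  "objective X y l A =
     1 / (2 * real CARD('n)) * (norm (y - obs_op X A))\<^sup>2 + l * nuclear_norm A"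

end

theory Submission
  imports Defs
begin

text \<open>
  Compare the estimator with the truth.  Let \<open>\<Delta>\<close> be the error, \<open>\<Delta>''\<close> its
  projection onto \<open>M\<^sup>\<bottom>\<close> and \<open>\<Delta>' = \<Delta> - \<Delta>''\<close>.  Optimality bounds the quadratic loss
  of \<open>\<Delta>\<close> by a noise term \<open>\<langle>X\<^sup>*(\<epsilon>), \<Delta>\<rangle> / N\<close> plus \<open>\<lambda>\<close> times the drop of the nuclear norm
  from the truth to the estimator.  The choice of \<open>\<lambda>\<close> and the duality between the operator and the
  nuclear norm make the noise term at most \<open>\<lambda>/2\<close> times \<open>\<parallel>\<Delta>'\<parallel>\<^sub>1 + \<parallel>\<Delta>''\<parallel>\<^sub>1\<close>.  The drop of the nuclear norm is
  at most \<open>\<parallel>\<Delta>'\<parallel>\<^sub>1 - \<parallel>\<Delta>''\<parallel>\<^sub>1\<close>, because the nuclear norm is additive on the truth and \<open>\<Delta>''\<close>, whose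
  row and column spaces are orthogonal (\<open>nuclear_norm_decomposable\<close>).  Hence the loss is at most
  \<open>\<lambda>/2\<close> times \<open>3 \<parallel>\<Delta>'\<parallel>\<^sub>1 - \<parallel>\<Delta>''\<parallel>\<^sub>1\<close>.  As the loss is nonnegative, \<open>\<Delta>\<close> lies in the
  cone on which the loss is at least \<open>\<kappa> \<parallel>\<Delta>\<parallel>\<^sup>2\<close>; and \<open>\<parallel>\<Delta>'\<parallel>\<^sub>1 \<le> \<surd>(2r) \<parallel>\<Delta>\<parallel>\<close> because \<open>\<Delta>'\<close> has rank at
  most \<open>2r\<close>.  Dividing by \<open>\<parallel>\<Delta>\<parallel>\<close> gives the bound, even with the constant \<open>3/\<surd>2\<close>.

  The facts about the nuclear norm all come from one description of it:  it is the maximum of the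
  trace inner product with a matrix \<open>C\<close> that does not increase the Euclidean norm
  (\<open>frobenius_inner_le_nuclear_norm\<close> and \<open>nuclear_norm_attained\<close>).  The
  triangle inequality is then immediate, and lower bounds such as decomposability amount to
  exhibiting one \<open>C\<close>.  To connect this with the definition by eigenvalues of \<open>A\<^sup>T A\<close>, the spectral
  theorem (\<open>self_adjoint_eigenbasis\<close>) supplies an orthonormal eigenbasis
  \<open>E\<close>; its image under \<open>A\<close> is orthogonal and the nuclear norm is
  the sum of \<open>\<parallel>A e\<parallel>\<close> over \<open>E\<close> (\<open>nuclear_norm_right_singular_basis\<close>).
\<close>

section \<open>Orthonormal bases and the spectral theorem\<close>

definition orthonormal_basis :: "'a::euclidean_space set \<Rightarrow> bool" where
  "orthonormal_basis E \<longleftrightarrow> pairwise orthogonal E \<and> (\<forall>e\<in>E. norm e = 1) \<and> span E = UNIV"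

text \<open>
  The Rayleigh quotient attains its maximum \<open>c\<close> over the unit sphere of the subspace, at some \<open>a\<close>.
  The quadratic form \<open>q x = c \<parallel>x\<parallel>\<^sup>2 - x \<bullet> f x\<close> is then nonnegative on the subspace and vanishes at
  \<open>a\<close>, so its first-order variation there vanishes too, and that variation is \<open>f a - c a\<close> up to a factor.
\<close>

lemma self_adjoint_eigenvector:
  fixes f :: "'a::euclidean_space \<Rightarrow> 'a"
  assumes f: "linear f" and sym: "\<And>x y. f x \<bullet> y = x \<bullet> f y"
    and S: "subspace S" and inv: "f ` S \<subseteq> S" and nontriv: "S \<noteq> {0}"
  obtains a c where "a \<in> S" "norm a = 1" "f a = c *\<^sub>R a"
proof -
  obtain w where w: "w \<in> S" "w \<noteq> 0" using nontriv subspace_0[OF S] by blast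
  have "(1 / norm w) *\<^sub>R w \<in> S \<inter> sphere 0 1"
    using w subspace_scale[OF S] by simp
  then have ne: "S \<inter> sphere 0 1 \<noteq> {}" by blast
  have "compact (S \<inter> sphere 0 1)"
    by (intro closed_Int_compact closed_subspace S compact_sphere)
  moreover have "continuous_on (S \<inter> sphere 0 1) (\<lambda>x. x \<bullet> f x)"
    by (intro continuous_intros linear_continuous_on_compose[OF _ f])
  ultimately obtain a where a: "a \<in> S" "norm a = 1"
    and max: "\<And>x. x \<in> S \<Longrightarrow> norm x = 1 \<Longrightarrow> x \<bullet> f x \<le> a \<bullet> f a"
    using continuous_attains_sup[OF _ ne, of "\<lambda>x. x \<bullet> f x"] by auto
  define c where "c = a \<bullet> f a"
  define q where "q x = c * (x \<bullet> x) - x \<bullet> f x" for x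
  have q_nonneg: "q x \<ge> 0" if "x \<in> S" for x
  proof (cases "x = 0")
    case False
    let ?x = "(1 / norm x) *\<^sub>R x"
    have "?x \<bullet> f ?x \<le> c"
      unfolding c_def using max[of ?x] that False subspace_scale[OF S] by simp
    then have "(x \<bullet> f x) / (norm x)\<^sup>2 \<le> c"
      by (simp add: linear_scale[OF f] power2_eq_square)
    then show ?thesis
      using False by (simp add: q_def divide_simps dot_square_norm mult.commute)
  qed (simp add: q_def)
  define z where "z = f a - c *\<^sub>R a"
  have zS: "z \<in> S" unfolding z_def using a inv S by (auto intro: subspace_diff subspace_scale)
  have "z = 0"
  proof (rule ccontr)
    assume "z \<noteq> 0"
    then have zz: "z \<bullet> z > 0" by simp
    have expand: "q (a + t *\<^sub>R z) = t * (t * q z - 2 * (z \<bullet> z))" for t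
    proof -
      have aa: "a \<bullet> a = 1" using a by (simp add: dot_square_norm)
      have "a \<bullet> f z = f a \<bullet> z" "z \<bullet> f a = f a \<bullet> z"
        by (rule sym[THEN HOL.sym], rule inner_commute)
      then have "q (a + t *\<^sub>R z) = t * (t * q z) + 2 * t * (c * (a \<bullet> z) - f a \<bullet> z)"
        by (simp add: q_def linear_add[OF f] linear_scale[OF f] inner_add_left inner_add_right aa
            c_def[symmetric] inner_commute[of z a] algebra_simps)
      moreover have "c * (a \<bullet> z) - f a \<bullet> z = - (z \<bullet> z)"
        by (simp add: z_def inner_diff_left algebra_simps)
      ultimately show ?thesis by (simp add: algebra_simps)
    qed
    \<comment> \<open>The linear term in \<open>t\<close> is negative; this step is short enough that the quadratic term cannot
      compensate it, and the added \<open>1\<close> keeps the denominator positive.\<close>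
    define t where "t = (z \<bullet> z) / (q z + 1)"
    have qz: "q z \<ge> 0" by (rule q_nonneg[OF zS])
    have t: "t > 0" using zz qz by (simp add: t_def)
    have "t * q z = (z \<bullet> z) * (q z / (q z + 1))" by (simp add: t_def)
    also have "\<dots> \<le> (z \<bullet> z) * 1" using zz qz by (intro mult_left_mono) auto
    finally have "t * q z - 2 * (z \<bullet> z) < 0" using zz by linarith
    then have "q (a + t *\<^sub>R z) < 0" unfolding expand using t by (simp add: mult_pos_neg)
    moreover have "q (a + t *\<^sub>R z) \<ge> 0" using a zS S by (intro q_nonneg subspace_add subspace_scale)
    ultimately show False by simp
  qed
  then show thesis using that[of a c] a by (simp add: z_def)
qed

text \<open>
  Self-adjointness makes the orthogonal complement of an eigenvector invariant again, so
  eigenvectors can be split off one dimension at a time.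
\<close>

lemma self_adjoint_eigenbasis_subspace:
  fixes f :: "'a::euclidean_space \<Rightarrow> 'a"
  assumes f: "linear f" and sym: "\<And>x y. f x \<bullet> y = x \<bullet> f y"
    and "subspace S" and "f ` S \<subseteq> S"
  shows "\<exists>E. pairwise orthogonal E \<and> (\<forall>e\<in>E. norm e = 1) \<and> span E = S \<and> (\<forall>e\<in>E. \<exists>c. f e = c *\<^sub>R e)"
  using assms(3,4)
proof (induction "dim S" arbitrary: S rule: less_induct)
  case less
  show ?case
  proof (cases "S = {0}")
    case True
    then show ?thesis by (intro exI[of _ "{}"]) auto
  next
    case False
    obtain a c where a: "a \<in> S" "norm a = 1" "f a = c *\<^sub>R a"
      using self_adjoint_eigenvector[OF f sym less.prems False] by blast
    have aa: "a \<bullet> a = 1" using a by (simp add: dot_square_norm)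
    define T where "T = S \<inter> {y. orthogonal a y}"
    have T: "subspace T"
      unfolding T_def by (rule subspace_inter[OF less.prems(1) subspace_orthogonal_to_vector])
    have "a \<notin> T" using aa by (auto simp: T_def orthogonal_def)
    then have "T \<subset> S" using a by (auto simp: T_def)
    then have dim: "dim T < dim S"
      using dim_psubset T less.prems by (metis span_eq_iff)
    have inv: "f ` T \<subseteq> T"
      using less.prems a by (auto simp: T_def orthogonal_def sym[symmetric])
    obtain E where E: "pairwise orthogonal E" "\<forall>e\<in>E. norm e = 1" "span E = T" "\<forall>e\<in>E. \<exists>c. f e = c *\<^sub>R e"
      using less.hyps[OF dim T inv] by blast
    have aE: "orthogonal a e" if "e \<in> E" for e
      using that E(3) span_base[of e E] by (auto simp: T_def)
    have "span (insert a E) = S"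
    proof
      show "span (insert a E) \<subseteq> S"
        using a E(3) span_superset[of E] less.prems by (intro span_minimal) (auto simp: T_def)
      show "S \<subseteq> span (insert a E)"
      proof
        fix x assume x: "x \<in> S"
        have "x - (a \<bullet> x) *\<^sub>R a \<in> T"
          using x a less.prems aa by (auto simp: T_def orthogonal_def inner_diff_right intro: subspace_diff subspace_scale)
        then show "x \<in> span (insert a E)"
          unfolding span_insert E(3) by blast
      qed
    qed
    moreover have "pairwise orthogonal (insert a E)"
      using E(1) aE by (auto simp: pairwise_insert orthogonal_commute)
    ultimately show ?thesis using a E by (intro exI[of _ "insert a E"]) auto
  qed
qed

theorem self_adjoint_eigenbasis:
  fixes f :: "'a::euclidean_space \<Rightarrow> 'a"
  assumes "linear f" and "\<And>x y. f x \<bullet> y = x \<bullet> f y"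
  obtains E where "orthonormal_basis E" "\<And>e. e \<in> E \<Longrightarrow> \<exists>c. f e = c *\<^sub>R e"
  using self_adjoint_eigenbasis_subspace[OF assms subspace_UNIV]
  unfolding orthonormal_basis_def by auto

context
  fixes E :: "'a::euclidean_space set"
  assumes E: "orthonormal_basis E"
begin

lemma orthonormal_basis_inner:
  assumes "e \<in> E" "e' \<in> E" shows "e \<bullet> e' = (if e = e' then 1 else 0)"
  using E assms by (auto simp: orthonormal_basis_def pairwise_def orthogonal_def dot_square_norm)

lemma orthonormal_basis_finite: "finite E"
  using E pairwise_orthogonal_imp_finite by (auto simp: orthonormal_basis_def)

lemma orthonormal_basis_nonempty: "E \<noteq> {}"
  using E by (auto simp: orthonormal_basis_def)

lemma orthonormal_basis_expansion: "(\<Sum>e\<in>E. (x \<bullet> e) *\<^sub>R e) = x"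
  using E by (intro orthonormal_basis_expand orthonormal_basis_finite) (auto simp: orthonormal_basis_def)

lemma orthonormal_basis_parseval: "x \<bullet> y = (\<Sum>e\<in>E. (x \<bullet> e) * (y \<bullet> e))"
  by (subst orthonormal_basis_expansion[of x, symmetric])
     (simp only: inner_sum_left inner_scaleR_left inner_commute[of y])

lemma orthonormal_basis_norm_sq: "(norm x)\<^sup>2 = (\<Sum>e\<in>E. (x \<bullet> e)\<^sup>2)"
  unfolding power2_norm_eq_inner by (subst orthonormal_basis_parseval) (simp add: power2_eq_square)

end

text \<open>
  The trace inner product is independent of the basis: Parseval's identity applied to the rows.
\<close>

lemma frobenius_inner_orthonormal_basis:
  fixes A B :: "real^'p^'k"
  assumes "orthonormal_basis E"
  shows "A \<bullet> B = (\<Sum>e\<in>E. (A *v e) \<bullet> (B *v e))"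
proof -
  have "A \<bullet> B = (\<Sum>i\<in>UNIV. \<Sum>e\<in>E. (A $ i \<bullet> e) * (B $ i \<bullet> e))"
    unfolding inner_vec_def[of A B] by (intro sum.cong refl orthonormal_basis_parseval[OF assms])
  also have "\<dots> = (\<Sum>e\<in>E. \<Sum>i\<in>UNIV. (A $ i \<bullet> e) * (B $ i \<bullet> e))" by (rule sum.swap)
  also have "\<dots> = (\<Sum>e\<in>E. (A *v e) \<bullet> (B *v e))"
    by (simp add: inner_vec_def[of "A *v _"] matrix_vector_mul_component)
  finally show ?thesis .
qed

section \<open>Right singular bases\<close>

lemma inner_matrix_vector_left:
  fixes A :: "real^'p^'k"
  shows "(A *v x) \<bullet> y = x \<bullet> (transpose A *v y)"
  by (metis dot_lmul_matrix inner_commute transpose_matrix_vector)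

text \<open>
  The eigenvalue belonging to a unit eigenvector \<open>e\<close> of \<open>A\<^sup>T A\<close> can only be \<open>\<parallel>A e\<parallel>\<^sup>2\<close>; naming it
  so avoids carrying the singular values along as separate data.
\<close>

definition right_singular_basis :: "real^'p^'k \<Rightarrow> (real^'p) set \<Rightarrow> bool" where
  "right_singular_basis A E \<longleftrightarrow>
     orthonormal_basis E \<and> (\<forall>e\<in>E. (transpose A ** A) *v e = (norm (A *v e))\<^sup>2 *\<^sub>R e)"

lemma right_singular_basis_exists:
  fixes A :: "real^'p^'k"
  obtains E where "right_singular_basis A E"
proof -
  have sym: "((transpose A ** A) *v x) \<bullet> y = x \<bullet> ((transpose A ** A) *v y)" for x y
    by (simp add: inner_matrix_vector_left matrix_transpose_mul)
  obtain E where E: "orthonormal_basis E"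
    and eig: "\<And>e. e \<in> E \<Longrightarrow> \<exists>c. (transpose A ** A) *v e = c *\<^sub>R e"
    using self_adjoint_eigenbasis[OF matrix_vector_mul_linear sym] by blast
  have "(transpose A ** A) *v e = (norm (A *v e))\<^sup>2 *\<^sub>R e" if e: "e \<in> E" for e
  proof -
    obtain c where c: "(transpose A ** A) *v e = c *\<^sub>R e" using eig[OF e] by blast
    have "(norm (A *v e))\<^sup>2 = e \<bullet> ((transpose A ** A) *v e)"
      by (simp add: power2_norm_eq_inner inner_matrix_vector_left matrix_vector_mul_assoc)
    also have "\<dots> = c" using orthonormal_basis_inner[OF E e e] by (simp add: c)
    finally show ?thesis using c by simp
  qed
  then show thesis using that E by (auto simp: right_singular_basis_def)
qed

context
  fixes A :: "real^'p^'k" and E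
  assumes A: "right_singular_basis A E"
begin

lemma right_singular_basis_orthonormal: "orthonormal_basis E"
  using A by (simp add: right_singular_basis_def)

lemma right_singular_basis_images_orthogonal:
  assumes "e \<in> E" "e' \<in> E" "e \<noteq> e'" shows "(A *v e) \<bullet> (A *v e') = 0"
proof -
  have "(A *v e) \<bullet> (A *v e') = e \<bullet> ((transpose A ** A) *v e')"
    by (simp add: inner_matrix_vector_left matrix_vector_mul_assoc)
  also have "\<dots> = 0"
    using A assms orthonormal_basis_inner[OF right_singular_basis_orthonormal assms(1,2)]
    by (simp add: right_singular_basis_def)
  finally show ?thesis .
qed

text \<open>
  Comparing coefficients in the eigenbasis: an eigenvector for \<open>s\<^sup>2\<close> has no component along basis
  vectors with another eigenvalue.
\<close>

lemma eigenspace_eq_span: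
  "eigenspace (transpose A ** A) (s\<^sup>2) = span {e\<in>E. norm (A *v e) = s}" if "s \<ge> 0"
proof
  let ?B = "transpose A ** A"
  note onb = right_singular_basis_orthonormal
  show "span {e\<in>E. norm (A *v e) = s} \<subseteq> eigenspace ?B (s\<^sup>2)"
  proof (rule span_minimal)
    show "subspace (eigenspace ?B (s\<^sup>2))"
      by (auto simp: subspace_def eigenspace_def matrix_vector_right_distrib matrix_vector_mult_scaleR scaleR_add_right)
  qed (use A in \<open>auto simp: right_singular_basis_def eigenspace_def\<close>)
  show "eigenspace ?B (s\<^sup>2) \<subseteq> span {e\<in>E. norm (A *v e) = s}"
  proof
    fix x assume "x \<in> eigenspace ?B (s\<^sup>2)"
    then have x: "?B *v x = s\<^sup>2 *\<^sub>R x" by (simp add: eigenspace_def)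
    have coeff: "x \<bullet> e = 0" if e: "e \<in> E" "norm (A *v e) \<noteq> s" for e
    proof -
      have "s\<^sup>2 * (x \<bullet> e) = (?B *v x) \<bullet> e" by (simp add: x)
      also have "\<dots> = x \<bullet> (?B *v e)" by (simp add: inner_matrix_vector_left matrix_transpose_mul)
      also have "\<dots> = (norm (A *v e))\<^sup>2 * (x \<bullet> e)" using A e by (simp add: right_singular_basis_def)
      finally have "s\<^sup>2 = (norm (A *v e))\<^sup>2 \<or> x \<bullet> e = 0" by auto
      then show ?thesis using e \<open>s \<ge> 0\<close> by (metis norm_ge_zero power2_eq_imp_eq)
    qed
    have "(\<Sum>e\<in>E. (x \<bullet> e) *\<^sub>R e) \<in> span {e\<in>E. norm (A *v e) = s}"
    proof (rule span_sum)
      fix e assume e: "e \<in> E"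
      show "(x \<bullet> e) *\<^sub>R e \<in> span {e\<in>E. norm (A *v e) = s}"
        using coeff[OF e] e by (cases "norm (A *v e) = s") (auto intro: span_base span_scale span_zero)
    qed
    then show "x \<in> span {e\<in>E. norm (A *v e) = s}"
      by (simp add: orthonormal_basis_expansion[OF onb])
  qed
qed

lemma singular_values_right_singular_basis: "singular_values A = (\<lambda>e. norm (A *v e)) ` E"
proof
  show "(\<lambda>e. norm (A *v e)) ` E \<subseteq> singular_values A"
  proof (rule image_subsetI)
    fix e assume "e \<in> E"
    with A show "norm (A *v e) \<in> singular_values A"
      unfolding right_singular_basis_def orthonormal_basis_def singular_values_def eigenspace_def
      by (intro CollectI conjI exI[of _ e]) auto
  qed
  show "singular_values A \<subseteq> (\<lambda>e. norm (A *v e)) ` E"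
  proof
    fix s assume "s \<in> singular_values A"
    then obtain w where s: "s \<ge> 0" and w: "w \<noteq> 0" "w \<in> eigenspace (transpose A ** A) (s\<^sup>2)"
      by (auto simp: singular_values_def)
    then have "w \<in> span {e\<in>E. norm (A *v e) = s}" using eigenspace_eq_span[OF s] by simp
    with \<open>w \<noteq> 0\<close> have "{e\<in>E. norm (A *v e) = s} \<noteq> {}" by (metis empty_iff insert_iff span_empty)
    then show "s \<in> (\<lambda>e. norm (A *v e)) ` E" by auto
  qed
qed

lemma singular_value_mult_right_singular_basis:
  assumes "s \<ge> 0"
  shows "singular_value_mult A s = card {e\<in>E. norm (A *v e) = s}"
proof -
  have "independent {e\<in>E. norm (A *v e) = s}"
    using right_singular_basis_orthonormal
    by (intro pairwise_orthogonal_independent) (auto simp: orthonormal_basis_def pairwise_def)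
  then show ?thesis
    by (simp add: singular_value_mult_def eigenspace_eq_span[OF assms] dim_eq_card_independent)
qed

text \<open>
  The multiplicity of \<open>s\<close> counts the basis vectors with \<open>\<parallel>A e\<parallel> = s\<close>, so the sum over distinct singular
  values with multiplicities is the sum over the basis grouped by value.
\<close>

lemma nuclear_norm_right_singular_basis: "nuclear_norm A = (\<Sum>e\<in>E. norm (A *v e))"
proof -
  let ?f = "\<lambda>e. norm (A *v e)"
  have "nuclear_norm A = (\<Sum>s\<in>?f ` E. real (card {e\<in>E. ?f e = s}) * s)"
    unfolding nuclear_norm_def singular_values_right_singular_basis
    by (intro sum.cong) (auto simp: singular_value_mult_right_singular_basis)
  also have "\<dots> = (\<Sum>s\<in>?f ` E. \<Sum>e\<in>{e\<in>E. ?f e = s}. ?f e)" by simp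
  also have "\<dots> = (\<Sum>e\<in>E. ?f e)"
    by (rule sum.image_gen[symmetric, OF orthonormal_basis_finite[OF right_singular_basis_orthonormal]])
  finally show ?thesis .
qed

end

section \<open>The operator norm and the dual description of the nuclear norm\<close>

text \<open>
  In a right singular basis the images \<open>A e\<close> are orthogonal, so \<open>\<parallel>A x\<parallel>\<^sup>2\<close> is the sum of the squared
  coordinates of \<open>x\<close> weighted by squared singular values.
\<close>

lemma norm_matrix_vector_le_op_norm:
  fixes A :: "real^'p^'k"
  shows "norm (A *v x) \<le> op_norm A * norm x"
proof -
  obtain E where A: "right_singular_basis A E" by (rule right_singular_basis_exists)
  note onb = right_singular_basis_orthonormal[OF A]
  note fin = orthonormal_basis_finite[OF onb]
  have bound: "norm (A *v e) \<le> op_norm A" if "e \<in> E" for e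
    using that fin by (simp add: op_norm_def singular_values_right_singular_basis[OF A])
  obtain e0 where "e0 \<in> E" using orthonormal_basis_nonempty[OF onb] by blast
  then have nonneg: "op_norm A \<ge> 0" by (rule order_trans[OF norm_ge_zero bound])
  have "A *v x = (\<Sum>e\<in>E. (x \<bullet> e) *\<^sub>R (A *v e))"
    by (subst orthonormal_basis_expansion[OF onb, of x, symmetric])
       (simp add: linear_sum[OF matrix_vector_mul_linear] matrix_vector_mult_scaleR)
  then have "(norm (A *v x))\<^sup>2 = (\<Sum>e\<in>E. (norm ((x \<bullet> e) *\<^sub>R (A *v e)))\<^sup>2)"
    using fin right_singular_basis_images_orthogonal[OF A]
    by (simp only:) (intro norm_sum_Pythagorean, auto simp: pairwise_def orthogonal_def)
  also have "\<dots> \<le> (\<Sum>e\<in>E. (op_norm A * \<bar>x \<bullet> e\<bar>)\<^sup>2)"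
    using bound by (intro sum_mono power_mono) (auto simp: mult.commute[of "op_norm A"] intro!: mult_left_mono)
  also have "\<dots> = (op_norm A * norm x)\<^sup>2"
    by (simp add: power_mult_distrib orthonormal_basis_norm_sq[OF onb, of x] sum_distrib_left)
  finally show ?thesis by (rule power2_le_imp_le) (simp add: nonneg)
qed

text \<open>
  Half of the duality between the operator and the nuclear norm: computed in a right singular basis of
  \<open>A\<close>, each term of the inner product is at most \<open>\<parallel>A e\<parallel> \<parallel>C e\<parallel> \<le> c \<parallel>A e\<parallel>\<close>.
\<close>

lemma frobenius_inner_le_nuclear_norm:
  fixes A C :: "real^'p^'k"
  assumes C: "\<And>x. norm (C *v x) \<le> c * norm x"
  shows "A \<bullet> C \<le> c * nuclear_norm A"
proof -
  obtain E where A: "right_singular_basis A E" by (rule right_singular_basis_exists)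
  note onb = right_singular_basis_orthonormal[OF A]
  have "A \<bullet> C = (\<Sum>e\<in>E. (A *v e) \<bullet> (C *v e))" by (rule frobenius_inner_orthonormal_basis[OF onb])
  also have "\<dots> \<le> (\<Sum>e\<in>E. norm (A *v e) * c)"
  proof (rule sum_mono)
    fix e assume "e \<in> E"
    then have "norm (C *v e) \<le> c" using C[of e] onb by (simp add: orthonormal_basis_def)
    then show "(A *v e) \<bullet> (C *v e) \<le> norm (A *v e) * c"
      using norm_cauchy_schwarz[of "A *v e" "C *v e"] by (meson mult_left_mono norm_ge_zero order_trans)
  qed
  also have "\<dots> = c * nuclear_norm A"
    by (simp add: nuclear_norm_right_singular_basis[OF A] sum_distrib_left mult.commute)
  finally show ?thesis .
qed

lemma outer_mult_vector: "outer a b *v x = (b \<bullet> x) *\<^sub>R a"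
  by (simp add: vec_eq_iff outer_def matrix_vector_mult_def inner_vec_def sum_distrib_right
        mult_ac sum_distrib_left)

lemma sum_matrix_vector_mult:
  fixes M :: "'i \<Rightarrow> real^'p^'k"
  shows "(\<Sum>j\<in>S. M j) *v x = (\<Sum>j\<in>S. M j *v x)"
  by (induction S rule: infinite_finite_induct) (auto simp: matrix_vector_mult_add_rdistrib)

text \<open>
  The other half: the partial isometry in the polar decomposition of \<open>A\<close>, which sends each \<open>e\<close> of a
  right singular basis to the unit vector along \<open>A e\<close>, attains the bound.
\<close>

lemma nuclear_norm_attained:
  fixes A :: "real^'p^'k"
  obtains C where "\<And>x. norm (C *v x) \<le> norm x" "A \<bullet> C = nuclear_norm A"
proof -
  obtain E where A: "right_singular_basis A E" by (rule right_singular_basis_exists)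
  note onb = right_singular_basis_orthonormal[OF A]
  note fin = orthonormal_basis_finite[OF onb]
  \<comment> \<open>Where \<open>A e = 0\<close> the summand is zero, by the convention \<open>1 / 0 = 0\<close>.\<close>
  define C where "C = (\<Sum>e\<in>E. outer ((1 / norm (A *v e)) *\<^sub>R (A *v e)) e)"
  have C: "C *v x = (\<Sum>e\<in>E. ((x \<bullet> e) / norm (A *v e)) *\<^sub>R (A *v e))" for x
    by (simp add: C_def sum_matrix_vector_mult outer_mult_vector inner_commute)
  have "norm (C *v x) \<le> norm x" for x
  proof -
    have "(norm (C *v x))\<^sup>2 = (\<Sum>e\<in>E. (norm (((x \<bullet> e) / norm (A *v e)) *\<^sub>R (A *v e)))\<^sup>2)"
      unfolding C using fin right_singular_basis_images_orthogonal[OF A]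
      by (intro norm_sum_Pythagorean) (auto simp: pairwise_def orthogonal_def)
    also have "\<dots> \<le> (\<Sum>e\<in>E. (x \<bullet> e)\<^sup>2)"
    proof (rule sum_mono)
      fix e
      show "(norm (((x \<bullet> e) / norm (A *v e)) *\<^sub>R (A *v e)))\<^sup>2 \<le> (x \<bullet> e)\<^sup>2"
        by (cases "A *v e = 0") simp_all
    qed
    also have "\<dots> = (norm x)\<^sup>2" by (simp add: orthonormal_basis_norm_sq[OF onb])
    finally show ?thesis by (rule power2_le_imp_le) simp
  qed
  moreover have "A \<bullet> C = nuclear_norm A"
  proof -
    have "C *v e = (1 / norm (A *v e)) *\<^sub>R (A *v e)" if "e \<in> E" for e
    proof -
      have "C *v e = (\<Sum>e'\<in>E. if e' = e then (1 / norm (A *v e)) *\<^sub>R (A *v e) else 0)"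
        unfolding C using that by (intro sum.cong) (auto simp: orthonormal_basis_inner[OF onb])
      then show ?thesis using that fin by simp
    qed
    then have "(A *v e) \<bullet> (C *v e) = norm (A *v e)" if "e \<in> E" for e
      using that by (simp add: dot_square_norm power2_eq_square)
    then show ?thesis
      unfolding frobenius_inner_orthonormal_basis[OF onb] nuclear_norm_right_singular_basis[OF A]
      by (intro sum.cong refl)
  qed
  ultimately show thesis by (rule that)
qed

lemma nuclear_norm_nonneg: "nuclear_norm A \<ge> 0"
  unfolding nuclear_norm_def by (intro sum_nonneg) (auto simp: singular_values_def)

lemma nuclear_norm_triangle: "nuclear_norm (A + B) \<le> nuclear_norm A + nuclear_norm B"
proof -
  obtain C where C: "\<And>x. norm (C *v x) \<le> 1 * norm x" "(A + B) \<bullet> C = nuclear_norm (A + B)"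
    using nuclear_norm_attained[of "A + B"] by auto
  then show ?thesis
    using frobenius_inner_le_nuclear_norm[OF C(1), of A] frobenius_inner_le_nuclear_norm[OF C(1), of B]
    by (simp add: inner_add_left)
qed

lemma nuclear_norm_minus: "nuclear_norm (- A) = nuclear_norm (A :: real^'p^'k)"
proof -
  have "transpose (- A) ** (- A) = transpose A ** A"
    by (simp add: vec_eq_iff matrix_matrix_mult_def transpose_def)
  then show ?thesis by (simp add: nuclear_norm_def singular_values_def singular_value_mult_def)
qed

text \<open>
  The nonzero \<open>A e\<close> are orthogonal vectors in the range of \<open>A\<close>, hence at most \<open>rank A\<close> many; the bound is
  the Cauchy--Schwarz inequality for the sum of their norms.
\<close>

lemma nuclear_norm_le_sqrt_rank:
  fixes A :: "real^'p^'k"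
  shows "nuclear_norm A \<le> sqrt (real (rank A)) * norm A"
proof -
  obtain E where A: "right_singular_basis A E" by (rule right_singular_basis_exists)
  note onb = right_singular_basis_orthonormal[OF A]
  note fin = orthonormal_basis_finite[OF onb]
  define F where "F = {e\<in>E. A *v e \<noteq> 0}"
  have F: "finite F" using fin by (simp add: F_def)
  have orth: "(A *v e) \<bullet> (A *v e') = 0" if "e \<in> F" "e' \<in> F" "e \<noteq> e'" for e e'
    using right_singular_basis_images_orthogonal[OF A] that by (auto simp: F_def)
  have "inj_on ((*v) A) F"
    by (rule inj_onI) (metis (mono_tags) F_def inner_eq_zero_iff mem_Collect_eq orth)
  then have "card F = card ((*v) A ` F)" by (simp add: card_image)
  also have "\<dots> \<le> rank A" unfolding rank_dim_range
  proof (rule independent_card_le_dim)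
    show "independent ((*v) A ` F)"
      using orth by (intro pairwise_orthogonal_independent) (auto simp: pairwise_def orthogonal_def F_def)
  qed auto
  finally have card: "card F \<le> rank A" .
  have "nuclear_norm A = (\<Sum>e\<in>F. norm (A *v e))"
    unfolding nuclear_norm_right_singular_basis[OF A] F_def
    using fin by (intro sum.mono_neutral_right) auto
  then have "(nuclear_norm A)\<^sup>2 \<le> (\<Sum>e\<in>F. (norm (A *v e))\<^sup>2) * card F"
    by (simp add: sum_squared_le_sum_of_squares)
  also have "\<dots> \<le> (\<Sum>e\<in>E. (norm (A *v e))\<^sup>2) * rank A"
    using card fin by (intro mult_mono sum_mono2) (auto simp: F_def sum_nonneg)
  also have "\<dots> = (sqrt (real (rank A)) * norm A)\<^sup>2"
    by (simp add: power_mult_distrib power2_norm_eq_inner frobenius_inner_orthonormal_basis[OF onb] mult.commute)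
  finally show ?thesis by (rule power2_le_imp_le) simp
qed

section \<open>Projections given by orthonormal families\<close>

lemma orthonormal_mono: "orthonormal m w \<Longrightarrow> r \<le> m \<Longrightarrow> orthonormal r w"
  by (simp add: orthonormal_def)

lemma norm_sq_orthonormal_combination:
  assumes "orthonormal r w"
  shows "(norm (\<Sum>j<r. c j *\<^sub>R w j))\<^sup>2 = (\<Sum>j<r. (c j)\<^sup>2)"
proof -
  have "(norm (\<Sum>j<r. c j *\<^sub>R w j))\<^sup>2 = (\<Sum>j<r. (norm (c j *\<^sub>R w j))\<^sup>2)"
    using assms by (intro norm_sum_Pythagorean) (auto simp: orthonormal_def pairwise_def orthogonal_def)
  also have "\<dots> = (\<Sum>j<r. (c j)\<^sup>2)"
  proof (rule sum.cong)
    fix j assume "j \<in> {..<r}"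
    then have "(norm (w j))\<^sup>2 = 1" using assms by (simp add: orthonormal_def power2_norm_eq_inner)
    then show "(norm (c j *\<^sub>R w j))\<^sup>2 = (c j)\<^sup>2" by (simp add: power_mult_distrib)
  qed simp
  finally show ?thesis .
qed

lemma transpose_compl_col_gram: "transpose (mat 1 - col_gram r w) = mat 1 - col_gram r w"
  using transpose_col_gram[of r w] by (simp add: vec_eq_iff transpose_def mat_def eq_commute)

lemma orthonormal_inner_compl_col_gram:
  assumes "orthonormal r w" "j < r"
  shows "w j \<bullet> ((mat 1 - col_gram r w) *v x) = 0"
  using inner_matrix_vector_left[of "mat 1 - col_gram r w" "w j" x] compl_col_gram_fix[OF assms]
  by (simp add: transpose_compl_col_gram)

text \<open>
  Pythagoras for the span of the family and its orthogonal complement, with Parseval's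
  formula for the first part.
\<close>

lemma norm_sq_split_compl_col_gram:
  assumes "orthonormal r w"
  shows "(norm x)\<^sup>2 = (\<Sum>j<r. (w j \<bullet> x)\<^sup>2) + (norm ((mat 1 - col_gram r w) *v x))\<^sup>2"
proof -
  let ?q = "(mat 1 - col_gram r w) *v x"
  have x: "x = (\<Sum>j<r. (w j \<bullet> x) *\<^sub>R w j) + ?q"
    by (simp add: matrix_vector_mult_diff_rdistrib col_gram_mult)
  have "orthogonal (\<Sum>j<r. (w j \<bullet> x) *\<^sub>R w j) ?q"
    using orthonormal_inner_compl_col_gram[OF assms] by (simp add: orthogonal_def inner_sum_left)
  then show ?thesis
    using norm_add_Pythagorean[of "\<Sum>j<r. (w j \<bullet> x) *\<^sub>R w j" ?q] x
    by (simp add: norm_sq_orthonormal_combination[OF assms])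
qed

lemma norm_compl_col_gram_le:
  assumes "orthonormal r w"
  shows "norm ((mat 1 - col_gram r w) *v x) \<le> norm x"
proof (rule power2_le_imp_le)
  show "(norm ((mat 1 - col_gram r w) *v x))\<^sup>2 \<le> (norm x)\<^sup>2"
    using norm_sq_split_compl_col_gram[OF assms, of x] by (simp add: sum_nonneg)
qed simp

section \<open>The projection onto \<open>M\<^sup>\<bottom>\<close>\<close>

lemma matrix_mult_inner_right:
  fixes A B :: "real^'p^'k"
  shows "(A ** M) \<bullet> B = A \<bullet> (B ** transpose M)"
proof -
  have "(A ** M) \<bullet> B = (transpose M ** transpose A) \<bullet> transpose B"
    by (metis matrix_transpose_mul transpose_inner)
  also have "\<dots> = transpose A \<bullet> transpose (B ** transpose M)"
    by (simp only: matrix_mult_inner transpose_transpose matrix_transpose_mul)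
  finally show ?thesis by (simp only: transpose_inner)
qed

lemma proj_Mperp_self_adjoint: "proj_Mperp r u v A \<bullet> B = A \<bullet> proj_Mperp r u v B"
  by (simp only: proj_Mperp_def matrix_mult_inner matrix_mult_inner_right transpose_compl_col_gram matrix_mul_assoc)

lemma proj_Mperp_mult_vector:
  "proj_Mperp r u v A *v x = (mat 1 - col_gram r u) *v (A *v ((mat 1 - col_gram r v) *v x))"
  by (simp add: proj_Mperp_def matrix_vector_mul_assoc matrix_mul_assoc)

lemma proj_Mperp_in_Mperp:
  assumes "orthonormal r u" "orthonormal r v"
  shows "proj_Mperp r u v A \<in> Mperp r u v"
  using compl_col_gram_fix[OF assms(1)] compl_col_gram_fix[OF assms(2)]
  by (simp add: Mperp_iff proj_Mperp_def matrix_transpose_mul transpose_compl_col_gram matrix_vector_mul_assoc[symmetric])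

lemma proj_Mperp_fix:
  assumes "B \<in> Mperp r u v" shows "proj_Mperp r u v B = B"
proof -
  have right: "B ** (mat 1 - col_gram r v) = B"
    using assms by (intro mult_compl_col_gram) (simp add: Mperp_iff)
  have "transpose B ** (mat 1 - col_gram r u) = transpose B"
    using assms by (intro mult_compl_col_gram) (simp add: Mperp_iff)
  then have "(mat 1 - col_gram r u) ** B = B"
    by (metis matrix_transpose_mul transpose_compl_col_gram transpose_transpose)
  with right show ?thesis by (simp add: proj_Mperp_def)
qed

lemma norm_diff_proj_Mperp_le:
  assumes "orthonormal r u" "orthonormal r v"
  shows "norm (A - proj_Mperp r u v A) \<le> norm A"
proof -
  let ?p = "proj_Mperp r u v A"
  have "?p \<bullet> ?p = A \<bullet> ?p"
    by (simp add: proj_Mperp_self_adjoint proj_Mperp_fix[OF proj_Mperp_in_Mperp[OF assms]])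
  then have "orthogonal (A - ?p) ?p" by (simp add: orthogonal_def inner_diff_left)
  then have "(norm A)\<^sup>2 = (norm (A - ?p))\<^sup>2 + (norm ?p)\<^sup>2"
    using norm_add_Pythagorean[of "A - ?p" ?p] by simp
  then have "(norm (A - ?p))\<^sup>2 \<le> (norm A)\<^sup>2" by simp
  then show ?thesis by (rule power2_le_imp_le) simp
qed

text \<open>
  With \<open>P = I - U U\<^sup>T\<close> and \<open>Q = I - V V\<^sup>T\<close>, the difference \<open>A - P A Q\<close> equals \<open>U U\<^sup>T A + P A V V\<^sup>T\<close>.  The
  range of the first summand lies in the span of the \<open>u j\<close>, that of the second in the span of the
  \<open>P A (v j)\<close>.
\<close>

lemma rank_diff_proj_Mperp_le:
  fixes u :: "nat \<Rightarrow> real^'k" and v :: "nat \<Rightarrow> real^'p"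
  shows "rank (A - proj_Mperp r u v A) \<le> 2 * r"
proof -
  let ?P = "mat 1 - col_gram r u" and ?Q = "mat 1 - col_gram r v"
  let ?W = "u ` {..<r} \<union> (\<lambda>j. ?P *v (A *v v j)) ` {..<r}"
  have "(A - proj_Mperp r u v A) *v x \<in> span ?W" for x
  proof -
    have Q: "?Q *v x = x - col_gram r v *v x" by (simp add: matrix_vector_mult_diff_rdistrib)
    have "(A - proj_Mperp r u v A) *v x = A *v x - ?P *v (A *v x) + ?P *v (A *v (col_gram r v *v x))"
      by (simp add: matrix_vector_mult_diff_rdistrib[of A] proj_Mperp_mult_vector Q matrix_vector_mult_diff_distrib)
    also have "A *v x - ?P *v (A *v x) = (\<Sum>j<r. (u j \<bullet> (A *v x)) *\<^sub>R u j)"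
      by (simp add: matrix_vector_mult_diff_rdistrib col_gram_mult)
    also have "?P *v (A *v (col_gram r v *v x)) = (\<Sum>j<r. (v j \<bullet> x) *\<^sub>R (?P *v (A *v v j)))"
      by (simp add: col_gram_mult[of r v] linear_sum[OF matrix_vector_mul_linear] matrix_vector_mult_scaleR)
    finally show ?thesis
      by (simp only:) (intro span_add span_sum span_scale span_base; auto)
  qed
  then have "rank (A - proj_Mperp r u v A) \<le> card ?W"
    unfolding rank_dim_range by (intro dim_le_card) auto
  also have "\<dots> \<le> card (u ` {..<r}) + card ((\<lambda>j. ?P *v (A *v v j)) ` {..<r})" by (rule card_Un_le)
  also have "\<dots> \<le> r + r" by (intro add_mono) (metis card_image_le card_lessThan finite_lessThan)+
  finally show ?thesis by simp
qed

section \<open>Decomposability of the nuclear norm\<close>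

lemma outer_inner: "outer a b \<bullet> C = a \<bullet> (C *v b)"
  by (simp add: inner_vec_def outer_def matrix_vector_mult_def sum_distrib_left mult_ac)

text \<open>
  Orthogonal row and column spaces let the dual certificates of the two summands be combined.  The
  certificate for \<open>A\<close> is \<open>W = U V\<^sup>T\<close>.  An arbitrary certificate for \<open>B\<close> is first projected, which does
  not change its inner product with \<open>B\<close>.  The sum of the two then does not increase norms, as they act on
  orthogonal subspaces and map into orthogonal subspaces.
\<close>

lemma nuclear_norm_decomposable:
  fixes u :: "nat \<Rightarrow> real^'k" and v :: "nat \<Rightarrow> real^'p"
  assumes u: "orthonormal r u" and v: "orthonormal r v"
    and s: "\<And>i. i < r \<Longrightarrow> s i \<ge> 0" and A: "A = (\<Sum>i<r. s i *\<^sub>R outer (u i) (v i))"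
    and B: "B \<in> Mperp r u v"
  shows "nuclear_norm A + nuclear_norm B \<le> nuclear_norm (A + B)"
proof -
  have A_inner: "A \<bullet> C = (\<Sum>i<r. s i * (u i \<bullet> (C *v v i)))" for C
    by (simp add: A inner_sum_left outer_inner)
  have unit: "norm (u i) = 1" "norm (v i) = 1" if "i < r" for i
    using u v that by (simp_all add: orthonormal_def norm_eq_1)
  obtain C\<^sub>A where CA: "\<And>x. norm (C\<^sub>A *v x) \<le> norm x" "A \<bullet> C\<^sub>A = nuclear_norm A"
    using nuclear_norm_attained[of A] by blast
  obtain C\<^sub>B where CB: "\<And>x. norm (C\<^sub>B *v x) \<le> norm x" "B \<bullet> C\<^sub>B = nuclear_norm B"
    using nuclear_norm_attained[of B] by blast
  define W where "W = (\<Sum>i<r. outer (u i) (v i))"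
  define C where "C = W + proj_Mperp r u v C\<^sub>B"
  have W: "W *v x = (\<Sum>i<r. (v i \<bullet> x) *\<^sub>R u i)" for x
    by (simp add: W_def sum_matrix_vector_mult outer_mult_vector)
  have C_contraction: "norm (C *v x) \<le> 1 * norm x" for x
  proof -
    let ?y = "proj_Mperp r u v C\<^sub>B *v x" and ?z = "(mat 1 - col_gram r v) *v x"
    have "norm ?y \<le> norm ?z"
      unfolding proj_Mperp_mult_vector
      using norm_compl_col_gram_le[OF u] CB(1) order_trans by blast
    then have y: "(norm ?y)\<^sup>2 \<le> (norm ?z)\<^sup>2" by (rule power_mono) simp
    have "orthogonal (W *v x) ?y"
      by (simp add: orthogonal_def W inner_sum_left proj_Mperp_mult_vector orthonormal_inner_compl_col_gram[OF u])
    then have "(norm (C *v x))\<^sup>2 = (norm (W *v x))\<^sup>2 + (norm ?y)\<^sup>2"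
      unfolding C_def matrix_vector_mult_add_rdistrib by (rule norm_add_Pythagorean)
    also have "\<dots> \<le> (\<Sum>i<r. (v i \<bullet> x)\<^sup>2) + (norm ?z)\<^sup>2"
      using y by (simp add: W norm_sq_orthonormal_combination[OF u])
    also have "\<dots> = (norm x)\<^sup>2" by (rule norm_sq_split_compl_col_gram[OF v, symmetric])
    finally have "norm (C *v x) \<le> norm x" by (rule power2_le_imp_le) simp
    then show ?thesis by simp
  qed
  \<comment> \<open>Both sides are compared with the sum of the \<open>s i\<close>: it bounds the nuclear norm from above, by
    duality, and equals the inner product with \<open>C\<close>.\<close>
  have "nuclear_norm A \<le> A \<bullet> C"
  proof -
    have "C *v v i = u i" if "i < r" for i
    proof -
      have "W *v v i = (\<Sum>j<r. if j = i then u i else 0)"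
        unfolding W using v that by (intro sum.cong) (auto simp: orthonormal_def)
      then show ?thesis
        using that by (simp add: C_def matrix_vector_mult_add_rdistrib proj_Mperp_mult_vector compl_col_gram_fix[OF v])
    qed
    moreover have "u i \<bullet> u i = 1" if "i < r" for i using u that by (simp add: orthonormal_def)
    ultimately have AC: "A \<bullet> C = (\<Sum>i<r. s i * 1)"
      unfolding A_inner by (intro sum.cong) simp_all
    have "nuclear_norm A = (\<Sum>i<r. s i * (u i \<bullet> (C\<^sub>A *v v i)))"
      unfolding CA(2)[symmetric] A_inner ..
    also have "\<dots> \<le> (\<Sum>i<r. s i * 1)"
    proof (intro sum_mono mult_left_mono)
      fix i assume "i \<in> {..<r}"
      then have i: "i < r" by simp
      have "u i \<bullet> (C\<^sub>A *v v i) \<le> norm (u i) * norm (C\<^sub>A *v v i)" by (rule norm_cauchy_schwarz)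
      also have "\<dots> \<le> 1" using CA(1)[of "v i"] unit[OF i] by simp
      finally show "u i \<bullet> (C\<^sub>A *v v i) \<le> 1" .
    qed (use s in auto)
    finally show ?thesis using AC by simp
  qed
  moreover have "B \<bullet> C = nuclear_norm B"
  proof -
    have "W \<bullet> B = 0" using B by (simp add: W_def inner_sum_left outer_inner Mperp_iff)
    moreover have "proj_Mperp r u v C\<^sub>B \<bullet> B = C\<^sub>B \<bullet> B"
      by (simp add: proj_Mperp_self_adjoint proj_Mperp_fix[OF B])
    ultimately show ?thesis using CB(2) by (simp add: C_def inner_add_right inner_commute)
  qed
  moreover have "(A + B) \<bullet> C \<le> nuclear_norm (A + B)"
    using frobenius_inner_le_nuclear_norm[OF C_contraction] by simp
  ultimately show ?thesis by (simp add: inner_add_left)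
qed

text \<open>
  If \<open>s i\<close> were positive for some \<open>i \<ge> r\<close>, then, the \<open>s j\<close> being non-increasing, the \<open>i + 1 > r\<close>
  orthonormal vectors \<open>u 0, \<dots>, u i\<close> would all lie in the range of \<open>A\<close>.
\<close>

lemma svd_truncate_at_rank:
  fixes A :: "real^'p^'k"
  assumes "is_svd A u s v"
  defines "r \<equiv> rank A"
  shows "orthonormal r u" "orthonormal r v" "\<And>i. i < r \<Longrightarrow> s i \<ge> 0"
    "A = (\<Sum>i<r. s i *\<^sub>R outer (u i) (v i))"
proof -
  define m where "m = min CARD('k) CARD('p)"
  have u: "orthonormal m u" and v: "orthonormal m v" and s: "\<And>i. i < m \<Longrightarrow> s i \<ge> 0"
    and dec: "\<And>i j. j < m \<Longrightarrow> i \<le> j \<Longrightarrow> s j \<le> s i"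
    and A: "A = (\<Sum>i<m. s i *\<^sub>R outer (u i) (v i))"
    using assms(1) by (auto simp: is_svd_def Let_def m_def)
  have rm: "r \<le> m" unfolding r_def m_def by (rule rank_bound)
  show "orthonormal r u" "orthonormal r v" "\<And>i. i < r \<Longrightarrow> s i \<ge> 0"
    using orthonormal_mono[OF u rm] orthonormal_mono[OF v rm] s rm by auto
  have "s i = 0" if i: "r \<le> i" "i < m" for i
  proof (rule ccontr)
    assume "s i \<noteq> 0"
    then have pos: "s j > 0" if "j \<le> i" for j
      using s[OF i(2)] dec[OF i(2) that] by linarith
    have unit: "norm (u j) = 1" if "j < m" for j
      using u that by (simp add: orthonormal_def norm_eq_1)
    have inj: "inj_on u {..i}"
    proof (rule inj_onI)
      fix j l assume jl: "j \<in> {..i}" "l \<in> {..i}" "u j = u l"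
      have "j < m" "l < m" using jl i by auto
      then have "u j \<bullet> u l = (if j = l then 1 else 0)" "u j \<bullet> u j = 1"
        using u by (simp_all add: orthonormal_def)
      then show "j = l" using jl(3) by (auto split: if_splits)
    qed
    have "u ` {..i} \<subseteq> range ((*v) A)"
    proof (rule image_subsetI)
      fix j assume "j \<in> {..i}"
      then have j: "j \<le> i" "j < m" using i by auto
      have "A *v v j = (\<Sum>l<m. if l = j then s j *\<^sub>R u j else 0)"
        unfolding A sum_matrix_vector_mult using v j
        by (intro sum.cong) (auto simp: scaleR_matrix_vector_assoc[symmetric] outer_mult_vector orthonormal_def)
      then have "A *v ((1 / s j) *\<^sub>R v j) = u j"
        using j pos[OF j(1)] by (simp add: matrix_vector_mult_scaleR)
      then show "u j \<in> range ((*v) A)" by (metis rangeI)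
    qed
    moreover have "independent (u ` {..i})"
    proof (rule pairwise_orthogonal_independent)
      show "pairwise orthogonal (u ` {..i})"
        using u i by (auto simp: pairwise_def orthogonal_def orthonormal_def)
      show "0 \<notin> u ` {..i}"
      proof
        assume "0 \<in> u ` {..i}"
        then obtain j where "j \<le> i" "u j = 0" by auto
        then show False using unit[of j] i by simp
      qed
    qed
    ultimately have "card (u ` {..i}) \<le> r"
      unfolding r_def rank_dim_range by (rule independent_card_le_dim)
    then show False using i by (simp add: card_image[OF inj])
  qed
  then show "A = (\<Sum>i<r. s i *\<^sub>R outer (u i) (v i))"
    unfolding A using rm by (intro sum.mono_neutral_right) auto
qed

section \<open>The observation operator and the error bound\<close>

lemma obs_op_component: "obs_op X A $ i = X i \<bullet> A"
  by (simp add: obs_op_def trace_def matrix_matrix_mult_def transpose_def inner_vec_def) (rule sum.swap)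

lemma obs_op_diff: "obs_op X (A - B) = obs_op X A - obs_op X B"
  by (simp add: vec_eq_iff obs_op_component inner_diff_right)

lemma obs_adj_inner: "obs_adj X e \<bullet> A = e \<bullet> obs_op X A"
  by (simp add: obs_adj_def inner_sum_left inner_vec_def[of e] obs_op_component)

text \<open>
  The residual at \<open>H\<close> is the noise minus the image of \<open>H - T\<close>; expanding its square and cancelling the
  pure noise term leaves the loss of \<open>H - T\<close> against the correlation with the noise.
\<close>

lemma basic_inequality:
  fixes X :: "'n::finite \<Rightarrow> real^'p^'k"
  assumes y: "y = obs_op X T + e"
    and le: "objective X y l H \<le> objective X y l T"
  shows "1 / (2 * real CARD('n)) * (norm (obs_op X (H - T)))\<^sup>2
      \<le> obs_adj X e \<bullet> (H - T) / real CARD('n) + l * (nuclear_norm T - nuclear_norm H)"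
proof -
  define g where "g = obs_op X (H - T)"
  have res: "y - obs_op X H = e - g" "y - obs_op X T = e" by (simp_all add: y g_def obs_op_diff)
  have "(norm (e - g))\<^sup>2 = (norm e)\<^sup>2 - 2 * (e \<bullet> g) + (norm g)\<^sup>2"
    by (simp add: power2_norm_eq_inner inner_diff_left inner_diff_right inner_commute)
  then have "1 / (2 * real CARD('n)) * ((norm e)\<^sup>2 - 2 * (e \<bullet> g) + (norm g)\<^sup>2) + l * nuclear_norm H
      \<le> 1 / (2 * real CARD('n)) * (norm e)\<^sup>2 + l * nuclear_norm T"
    using le by (simp only: objective_def res)
  moreover have "1 / (2 * real CARD('n)) * ((norm e)\<^sup>2 - 2 * (e \<bullet> g) + (norm g)\<^sup>2)
      = 1 / (2 * real CARD('n)) * (norm e)\<^sup>2 - e \<bullet> g / real CARD('n) + 1 / (2 * real CARD('n)) * (norm g)\<^sup>2"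
    by (simp add: field_simps)
  ultimately show ?thesis
    unfolding obs_adj_inner g_def[symmetric] right_diff_distrib by linarith
qed

theorem corollary1:
  fixes Theta Theta_hat :: "real^'p^'k"
    and X :: "'n::finite \<Rightarrow> real^'p^'k"
    and eps y :: "real^'n"
    and u :: "nat \<Rightarrow> real^'k" and v :: "nat \<Rightarrow> real^'p" and s :: "nat \<Rightarrow> real"
    and r :: nat and \<kappa> l :: real
  assumes "rank Theta = r" and "r \<ge> 1"
    and "is_svd Theta u s v"
    and "y = obs_op X Theta + eps"
    and "\<kappa> > 0" and "RSC X \<kappa> (cone_set Theta u v r 0)"
    and "l > 0" and "l \<ge> 2 * op_norm (obs_adj X eps) / real CARD('n)"
    and "is_arg_min (objective X y l) (\<lambda>_. True) Theta_hat"
  shows "norm (Theta_hat - Theta) \<le> 32 * sqrt (real r) * l / \<kappa>"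
proof -
  note svd = svd_truncate_at_rank[OF assms(3), unfolded assms(1)]
  define N where "N = real CARD('n)"
  have N: "N > 0" by (simp add: N_def)
  define D where "D = Theta_hat - Theta"
  define D2 where "D2 = proj_Mperp r u v D"
  define D1 where "D1 = D - D2"
  let ?loss = "1 / (2 * N) * (norm (obs_op X D))\<^sup>2"
  let ?n1 = "nuclear_norm D1" and ?n2 = "nuclear_norm D2"

  have "objective X y l Theta_hat \<le> objective X y l Theta"
    using assms(9) by (simp add: is_arg_min_linorder)
  note basic = basic_inequality[OF assms(4) this, folded D_def N_def]

  have "obs_adj X eps \<bullet> D \<le> op_norm (obs_adj X eps) * nuclear_norm D"
    using frobenius_inner_le_nuclear_norm[OF norm_matrix_vector_le_op_norm] by (subst inner_commute)
  also have "\<dots> \<le> (N * l / 2) * nuclear_norm D"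
    using assms(8) N by (intro mult_right_mono nuclear_norm_nonneg) (simp add: N_def field_simps)
  also have "\<dots> \<le> (N * l / 2) * (?n1 + ?n2)"
    using nuclear_norm_triangle[of D1 D2] N assms(7) by (intro mult_left_mono) (simp_all add: D1_def)
  finally have noise: "obs_adj X eps \<bullet> D / N \<le> l / 2 * (?n1 + ?n2)"
    using N by (simp add: field_simps)

  have "nuclear_norm Theta + ?n2 \<le> nuclear_norm (Theta + D2)"
    unfolding D2_def by (rule nuclear_norm_decomposable[OF svd proj_Mperp_in_Mperp[OF svd(1,2)]])
  also have "Theta + D2 = Theta_hat + - D1" by (simp add: D1_def D_def)
  also have "nuclear_norm \<dots> \<le> nuclear_norm Theta_hat + ?n1"
    using nuclear_norm_triangle[of Theta_hat "- D1"] by (simp only: nuclear_norm_minus)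
  finally have "l * (nuclear_norm Theta - nuclear_norm Theta_hat) \<le> l * (?n1 - ?n2)"
    using assms(7) by (intro mult_left_mono) auto
  with basic noise have loss: "?loss \<le> l / 2 * (3 * ?n1 - ?n2)"
    by (simp add: algebra_simps)

  have "0 \<le> l / 2 * (3 * ?n1 - ?n2)" by (rule order_trans[OF _ loss]) (use N in simp)
  then have "?n2 \<le> 3 * ?n1" using assms(7) by (simp add: zero_le_mult_iff)
  then have "D \<in> cone_set Theta u v r 0"
    using nuclear_norm_nonneg[of "proj_Mperp r u v Theta"] by (simp add: cone_set_def D1_def D2_def)
  then have "\<kappa> * (norm D)\<^sup>2 \<le> ?loss"
    using assms(6) by (auto simp: RSC_def N_def)
  also have "\<dots> \<le> l / 2 * (3 * ?n1)"
    using loss assms(7) nuclear_norm_nonneg[of D2] by (smt (verit) mult_left_mono divide_nonneg_nonneg)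
  also have "?n1 \<le> sqrt (2 * real r) * norm D"
  proof -
    have "?n1 \<le> sqrt (real (rank D1)) * norm D1" by (rule nuclear_norm_le_sqrt_rank)
    also have "\<dots> \<le> sqrt (2 * real r) * norm D"
      using rank_diff_proj_Mperp_le[where A=D and r=r and u=u and v=v]
        norm_diff_proj_Mperp_le[OF svd(1,2), of D]
      by (intro mult_mono) (simp_all add: D1_def D2_def flip: of_nat_mult)
    finally show ?thesis .
  qed
  finally have "\<kappa> * (norm D)\<^sup>2 \<le> l / 2 * (3 * (sqrt (2 * real r) * norm D))"
    using assms(7) by simp
  then have "norm D * (\<kappa> * norm D) \<le> norm D * (3 / 2 * sqrt 2 * (sqrt (real r) * l))"
    by (simp add: real_sqrt_mult power2_eq_square algebra_simps)
  then have "\<kappa> * norm D \<le> 3 / 2 * sqrt 2 * (sqrt (real r) * l)" if "D \<noteq> 0"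
    using that by (simp add: mult_le_cancel_left)
  moreover have "3 / 2 * sqrt 2 * (sqrt (real r) * l) \<le> 32 * (sqrt (real r) * l)"
    using assms(7) sqrt2_less_2 by (intro mult_right_mono) auto
  ultimately have "\<kappa> * norm D \<le> 32 * (sqrt (real r) * l)"
    using assms(7) by (cases "D = 0") auto
  then show ?thesis
    using assms(5) by (simp add: D_def field_simps)
qed

end
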